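(* Let $u\in C(\mathbb R^2)$ be an $\infty$-harmonic function in $\mathbb R^2$. If for some $p>2$ the function $u$ satisfies the $L^p$-vanishing condition $$\liminf_{R\to\infty}\frac1R\left(\frac1{R^2}\int_{B(0,R)}|u(x)|^p\,dx\right)^{1/p}=0,$$ then $u$ must be a constant function.
   Context: A function $u\in C(\mathbb R^2)$ is $\infty$-harmonic in $\mathbb R^2$ if $-\Delta_\infty u:=-\sum_{i,j}u_iu_ju_{ij}=0$ in $\mathbb R^2$ in the viscosity sense. $B(0,R)$ is the ball of radius $R$ centered at the origin. *)

theory Defs
  imports "HOL-Analysis.Analysis"
begin

definition partial_deriv :: "'n \<Rightarrow> (real ^ 'n \<Rightarrow> real) \<Rightarrow> real ^ 'n::finite \<Rightarrow> real" where
  "partial_deriv i f x = frechet_derivative f (at x) (axis i 1)"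

text \<open>Meaningful for open \<open>V\<close>, the only case in which it is used below.\<close>

definition C2_on :: "(real ^ 'n::finite) set \<Rightarrow> (real ^ 'n \<Rightarrow> real) \<Rightarrow> bool" where
  "C2_on V f \<longleftrightarrow>
     (\<forall>x\<in>V. f differentiable (at x)) \<and>
     (\<forall>i. \<forall>x\<in>V. partial_deriv i f differentiable (at x)) \<and>
     (\<forall>i j. continuous_on V (partial_deriv j (partial_deriv i f)))"

definition infinity_laplacian :: "(real ^ 'n::finite \<Rightarrow> real) \<Rightarrow> real ^ 'n \<Rightarrow> real" where
  "infinity_laplacian f x =
     (\<Sum>i\<in>UNIV. \<Sum>j\<in>UNIV.
        partial_deriv i f x * partial_deriv j f x * partial_deriv j (partial_deriv i f) x)"

text \<open>
  Viscosity solutions of \<open>- infinity_laplacian u = 0\<close> in an open set \<open>U\<close>.  Test functions are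
  \<open>C\<^sup>2\<close> near the point of contact only; since the open neighbourhood \<open>V\<close> may be shrunk, an extremum
  of \<open>u - \<phi>\<close> over \<open>V\<close> is the same as a local extremum.
\<close>

definition viscosity_subsolution_on :: "(real ^ 'n::finite) set \<Rightarrow> (real ^ 'n \<Rightarrow> real) \<Rightarrow> bool" where
  "viscosity_subsolution_on U u \<longleftrightarrow>
     (\<forall>V \<phi> x. open V \<and> V \<subseteq> U \<and> x \<in> V \<and> C2_on V \<phi> \<and>
        (\<forall>y\<in>V. u y - \<phi> y \<le> u x - \<phi> x) \<longrightarrow> - infinity_laplacian \<phi> x \<le> 0)"

definition viscosity_supersolution_on :: "(real ^ 'n::finite) set \<Rightarrow> (real ^ 'n \<Rightarrow> real) \<Rightarrow> bool" where
  "viscosity_supersolution_on U u \<longleftrightarrow>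
     (\<forall>V \<phi> x. open V \<and> V \<subseteq> U \<and> x \<in> V \<and> C2_on V \<phi> \<and>
        (\<forall>y\<in>V. u y - \<phi> y \<ge> u x - \<phi> x) \<longrightarrow> - infinity_laplacian \<phi> x \<ge> 0)"

definition infinity_harmonic_on :: "(real ^ 'n::finite) set \<Rightarrow> (real ^ 'n \<Rightarrow> real) \<Rightarrow> bool" where
  "infinity_harmonic_on U u \<longleftrightarrow>
     continuous_on U u \<and> viscosity_subsolution_on U u \<and> viscosity_supersolution_on U u"

end

theory Submission imports Defs
begin

text \<open>
  Everything rests on comparison with cones.  A subsolution \<open>u\<close> whose increments \<open>u x - u y\<close> are at
  most \<open>K\<close> on a ball of radius \<open>r\<close> about \<open>y\<close> stays below the cone \<open>u y + K / r * dist x y\<close> there.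
  The cone itself is \<open>\<infinity>\<close>-harmonic away from its vertex, so it gives no contradiction as a test
  function; but a concave power \<open>s powr b\<close> of the distance with \<open>b < 1\<close> is a strict supersolution,
  which \<open>u\<close> cannot touch from below (\<open>subsolution_below_radial_power\<close>), and \<open>b \<rightarrow> 1\<close> gives the cone
  (\<open>subsolution_below_cone\<close>).  Applied to \<open>u\<close> and \<open>- u\<close> this turns a bound on \<open>u\<close> into a Lipschitz
  bound at the centre of the ball (\<open>infinity_harmonic_lipschitz\<close>).

  The Lipschitz bound makes the supremum controllable by the \<open>L\<^sup>p\<close> norm
  (\<open>infinity_harmonic_interior_estimate\<close>): where \<open>\<bar>u\<bar>\<close> takes a value that is large compared with its
  surroundings, it stays at least half as large on a ball of comparable radius, and this ball alone
  contributes enough to the integral.  The point is chosen to maximise \<open>(R - norm x) ^ n * \<bar>u x\<bar> powr p\<close>,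
  the weight with the scaling of the integral; because it vanishes on the boundary, the chosen point has
  room around it, and maximality bounds \<open>\<bar>u\<bar>\<close> nearby by a multiple of its value there.

  The vanishing condition then says that \<open>\<bar>u\<bar>\<close> is at most \<open>e * R\<close> on the ball of radius \<open>R / 2\<close>, for
  every \<open>e > 0\<close> and suitable arbitrarily large \<open>R\<close>.  Used once more, the Lipschitz bound on these
  balls forces \<open>u\<close> to be constant (\<open>infinity_harmonic_constant_if_sublinear\<close>).
\<close>

section \<open>Partial derivatives\<close>

lemma partial_deriv_eqI:
  assumes "(f has_derivative f') (at x)"
  shows "partial_deriv i f x = f' (axis i 1)"
  using frechet_derivative_at[OF assms] by (simp add: partial_deriv_def)

lemma has_derivative_uminus_at:
  assumes "f differentiable (at x)"
  shows "((\<lambda>y. - f y) has_derivative (\<lambda>h. - frechet_derivative f (at x) h)) (at x)"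
  using assms frechet_derivative_works has_derivative_minus by blast

text \<open>
  Openness of \<open>V\<close> matters: \<open>frechet_derivative\<close> is an arbitrary choice where the derivative does not
  exist, so the first partial derivatives of \<open>- f\<close> and \<open>f\<close> are only known to be opposite on \<open>V\<close>, and
  differentiating them again needs this on a neighbourhood of the point.
\<close>

lemma C2_on_uminus:
  fixes f :: "real ^ 'n::finite \<Rightarrow> real"
  assumes V: "open V" and f: "C2_on V f"
  shows "C2_on V (\<lambda>x. - f x)"
    and "x \<in> V \<Longrightarrow> infinity_laplacian (\<lambda>x. - f x) x = - infinity_laplacian f x"
proof -
  have df: "f differentiable (at x)" if "x \<in> V" for x
    using f that by (simp add: C2_on_def)
  have dpf: "partial_deriv i f differentiable (at x)" if "x \<in> V" for x i
    using f that by (simp add: C2_on_def)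
  have cpf: "continuous_on V (partial_deriv j (partial_deriv i f))" for i j
    using f by (simp add: C2_on_def)
  have p1: "partial_deriv i (\<lambda>x. - f x) x = - partial_deriv i f x" if "x \<in> V" for x i
    using partial_deriv_eqI[OF has_derivative_uminus_at[OF df[OF that]]]
    by (simp add: partial_deriv_def)
  have dp: "(partial_deriv i (\<lambda>x. - f x) has_derivative
              (\<lambda>h. - frechet_derivative (partial_deriv i f) (at x) h)) (at x)"
    if "x \<in> V" for x i
    by (rule has_derivative_transform_within_open
        [OF has_derivative_uminus_at[OF dpf[OF that]] V that]) (simp add: p1)
  have p2: "partial_deriv j (partial_deriv i (\<lambda>x. - f x)) x = - partial_deriv j (partial_deriv i f) x"
    if "x \<in> V" for x i j
    using partial_deriv_eqI[OF dp[OF that]] by (simp add: partial_deriv_def)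
  show "C2_on V (\<lambda>x. - f x)"
    unfolding C2_on_def
  proof (intro conjI allI ballI)
    show "(\<lambda>x. - f x) differentiable at x" if "x \<in> V" for x
      using df[OF that] by simp
    show "partial_deriv i (\<lambda>x. - f x) differentiable at x" if "x \<in> V" for x i
      using dp[OF that] by (rule differentiableI)
    show "continuous_on V (partial_deriv j (partial_deriv i (\<lambda>x. - f x)))" for i j
      by (subst continuous_on_cong[OF refl p2]) (auto intro: continuous_on_minus cpf)
  qed
  show "infinity_laplacian (\<lambda>x. - f x) x = - infinity_laplacian f x" if "x \<in> V"
    using that by (simp add: infinity_laplacian_def p1 p2 sum_negf)
qed

lemma viscosity_subsolution_uminus:
  fixes u :: "real ^ 'n::finite \<Rightarrow> real"
  assumes "viscosity_supersolution_on U u"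
  shows "viscosity_subsolution_on U (\<lambda>x. - u x)"
  unfolding viscosity_subsolution_on_def
proof (intro allI impI, elim conjE)
  fix V \<phi> x
  assume V: "open V" "V \<subseteq> U" "x \<in> V" and \<phi>: "C2_on V \<phi>"
    and max: "\<forall>y\<in>V. - u y - \<phi> y \<le> - u x - \<phi> x"
  have "\<forall>y\<in>V. u y - (- \<phi> y) \<ge> u x - (- \<phi> x)"
    using max by force
  then have "- infinity_laplacian (\<lambda>x. - \<phi> x) x \<ge> 0"
    using assms V C2_on_uminus(1)[OF V(1) \<phi>]
    unfolding viscosity_supersolution_on_def by blast
  then show "- infinity_laplacian \<phi> x \<le> 0"
    using C2_on_uminus(2)[OF V(1) \<phi> V(3)] by simp
qed

section \<open>Radial powers as strict supersolutions\<close>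

lemma has_derivative_radial_power:
  fixes x y :: "real ^ 'n::finite"
  assumes "x \<noteq> y"
  shows "((\<lambda>x. ((x - y) \<bullet> (x - y)) powr a) has_derivative
          (\<lambda>h. 2 * a * ((x - y) \<bullet> (x - y)) powr (a - 1) * ((x - y) \<bullet> h))) (at x)"
proof -
  have q: "((\<lambda>x. (x - y) \<bullet> (x - y)) has_derivative (\<lambda>h. 2 * ((x - y) \<bullet> h))) (at x)"
    by (auto intro!: derivative_eq_intros simp: inner_commute)
  have "(x - y) \<bullet> (x - y) > 0"
    using assms by simp
  then have "((\<lambda>s. s powr a) has_derivative (\<lambda>h. (a * ((x - y) \<bullet> (x - y)) powr (a - 1)) * h))
      (at ((x - y) \<bullet> (x - y)))"
    using has_real_derivative_powr has_field_derivative_imp_has_derivative by blast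
  from has_derivative_compose[OF q this] show ?thesis
    by (simp add: mult.assoc mult.commute mult.left_commute)
qed

text \<open>
  With \<open>q = (dist x y)\<^sup>2\<close> and \<open>g s = A * s powr a\<close>, the chain rule gives the \<open>\<infinity>\<close>-Laplacian
  \<open>8 * (g' q) ^ 3 * q + 16 * (g' q)\<^sup>2 * g'' q * q\<^sup>2\<close>, and \<open>g'' q * q = (a - 1) * g' q\<close> merges the two terms.
  The factor \<open>2 * a - 1\<close> is what makes the function a strict supersolution for \<open>A > 0\<close> and
  \<open>0 < a < 1 / 2\<close>.
\<close>

lemma infinity_laplacian_radial_power:
  fixes y :: "real ^ 'n::finite" and A a c :: real
  defines "\<phi> \<equiv> \<lambda>x. c + A * ((x - y) \<bullet> (x - y)) powr a"
  assumes V: "open V" "y \<notin> V"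
  shows "C2_on V \<phi>"
    and "x \<in> V \<Longrightarrow> infinity_laplacian \<phi> x =
      8 * (A * a) ^ 3 * (2 * a - 1) * (((x - y) \<bullet> (x - y)) powr (a - 1)) ^ 3 * ((x - y) \<bullet> (x - y))"
proof -
  define q where "q x = (x - y) \<bullet> (x - y)" for x
  have qpos: "q x > 0" if "x \<in> V" for x
    using that V by (auto simp: q_def)
  have ne: "x \<noteq> y" if "x \<in> V" for x
    using that V by auto
  have d1: "(\<phi> has_derivative (\<lambda>h. A * (2 * a * q x powr (a - 1) * ((x - y) \<bullet> h)))) (at x)"
    if "x \<in> V" for x
    unfolding \<phi>_def q_def
    using has_derivative_add[OF has_derivative_const has_derivative_mult_right
        [OF has_derivative_radial_power[OF ne[OF that]]]]
    by simp
  have p1: "partial_deriv i \<phi> x = 2 * A * a * (q x powr (a - 1) * (x - y) $ i)"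
    if "x \<in> V" for x i
    using partial_deriv_eqI[OF d1[OF that]] by (simp add: inner_axis)
  have d2: "(partial_deriv i \<phi> has_derivative
      (\<lambda>h. 2 * A * a * (q x powr (a - 1) * h $ i
         + 2 * (a - 1) * q x powr (a - 2) * ((x - y) \<bullet> h) * (x - y) $ i))) (at x)"
    if "x \<in> V" for x i
  proof (rule has_derivative_transform_within_open[OF _ V(1) that])
    have c: "((\<lambda>x. (x - y) $ i) has_derivative (\<lambda>h. h $ i)) (at x)"
      by (auto intro!: derivative_eq_intros bounded_linear.has_derivative[OF bounded_linear_vec_nth])
    have e: "a - 1 - 1 = a - 2" by simp
    show "((\<lambda>x. 2 * A * a * (q x powr (a - 1) * (x - y) $ i)) has_derivative
      (\<lambda>h. 2 * A * a * (q x powr (a - 1) * h $ i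
         + 2 * (a - 1) * q x powr (a - 2) * ((x - y) \<bullet> h) * (x - y) $ i))) (at x)"
      using has_derivative_mult_right[OF has_derivative_mult
          [OF has_derivative_radial_power[OF ne[OF that], of "a - 1"] c], of "2 * A * a"]
      unfolding q_def e .
  qed (simp add: p1)
  have p2: "partial_deriv j (partial_deriv i \<phi>) x =
      2 * A * a * (q x powr (a - 1) * (if i = j then 1 else 0)
         + 2 * (a - 1) * q x powr (a - 2) * (x - y) $ j * (x - y) $ i)"
    if "x \<in> V" for x i j
  proof -
    have "axis j (1 :: real) $ i = (if i = j then 1 else 0)"
      by (simp add: axis_def)
    then show ?thesis
      unfolding partial_deriv_eqI[OF d2[OF that]] by (simp add: inner_axis)
  qed
  show "C2_on V \<phi>"
    unfolding C2_on_def
  proof (intro conjI allI ballI)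
    show "\<phi> differentiable at x" if "x \<in> V" for x
      using d1[OF that] by (rule differentiableI)
    show "partial_deriv i \<phi> differentiable at x" if "x \<in> V" for x i
      using d2[OF that] by (rule differentiableI)
    have "continuous_on V (\<lambda>x. 2 * A * a * (q x powr (a - 1) * (if i = j then 1 else 0)
         + 2 * (a - 1) * q x powr (a - 2) * (x - y) $ j * (x - y) $ i))" for i j
      unfolding q_def using ne by (intro continuous_intros) auto
    then show "continuous_on V (partial_deriv j (partial_deriv i \<phi>))" for i j
      by (subst continuous_on_cong[OF refl p2]) auto
  qed
  show "infinity_laplacian \<phi> x =
      8 * (A * a) ^ 3 * (2 * a - 1) * (((x - y) \<bullet> (x - y)) powr (a - 1)) ^ 3 * ((x - y) \<bullet> (x - y))"
    if x: "x \<in> V"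
  proof -
    define B Q1 Q2 h where "B = 2 * A * a" and "Q1 = q x powr (a - 1)"
      and "Q2 = q x powr (a - 2)" and "h = x - y"
    have Q2: "Q2 * q x = Q1"
      using powr_add[of "q x" "a - 2" 1] qpos[OF x] by (simp add: Q1_def Q2_def)
    have qs: "q x = (\<Sum>i\<in>UNIV. h $ i * h $ i)"
      by (simp add: q_def h_def inner_vec_def)
    have "infinity_laplacian \<phi> x = (\<Sum>i\<in>UNIV. \<Sum>j\<in>UNIV.
        B ^ 3 * Q1 ^ 3 * (if i = j then h $ i * h $ j else 0)
          + B ^ 3 * Q1 ^ 2 * 2 * (a - 1) * Q2 * ((h $ i * h $ i) * (h $ j * h $ j)))"
      unfolding infinity_laplacian_def p1[OF x] p2[OF x] B_def[symmetric] Q1_def[symmetric]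
        Q2_def[symmetric] h_def[symmetric]
      by (intro sum.cong refl) (simp add: algebra_simps power2_eq_square power3_eq_cube)
    also have "\<dots> = B ^ 3 * Q1 ^ 3 * q x + B ^ 3 * Q1 ^ 2 * 2 * (a - 1) * Q2 * (q x * q x)"
      by (simp add: sum.distrib sum_distrib_left[symmetric] sum_distrib_right[symmetric] qs)
    also have "\<dots> = B ^ 3 * Q1 ^ 3 * q x + B ^ 3 * Q1 ^ 2 * 2 * (a - 1) * (Q2 * q x) * q x"
      by simp
    also have "\<dots> = B ^ 3 * (2 * a - 1) * Q1 ^ 3 * q x"
      unfolding Q2 by (simp add: algebra_simps power2_eq_square power3_eq_cube)
    finally show ?thesis
      by (simp add: B_def Q1_def q_def power_mult_distrib mult.assoc)
  qed
qed

section \<open>Comparison with cones\<close>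

text \<open>
  The comparison function agrees with \<open>u\<close> at \<open>y\<close> and is at least \<open>u\<close> on the sphere of radius \<open>r\<close>.  If
  \<open>u\<close> exceeded it anywhere, the difference would have its maximum in the punctured open ball, where
  the comparison function is an admissible test function with negative \<open>\<infinity>\<close>-Laplacian.
\<close>

lemma subsolution_below_radial_power:
  fixes u :: "real ^ 'n::finite \<Rightarrow> real"
  assumes sub: "viscosity_subsolution_on UNIV u" and cont: "continuous_on UNIV u"
    and r: "r > 0" and K: "K > 0"
    and bound: "\<And>x. x \<in> cball y r \<Longrightarrow> u x - u y \<le> K"
    and a: "0 < a" "a < 1 / 2"
    and x: "x \<in> cball y r"
  shows "u x - u y \<le> K * (dist x y / r) powr (2 * a)"
proof -
  define A where "A = K / (r\<^sup>2) powr a"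
  define \<phi> where "\<phi> = (\<lambda>x. u y + A * ((x - y) \<bullet> (x - y)) powr a)"
  define V where "V = ball y r - {y}"
  have A: "A > 0"
    using K r by (simp add: A_def)
  have "continuous_on (cball y r) (\<lambda>x. u x - \<phi> x)"
    unfolding \<phi>_def using a continuous_on_subset[OF cont]
    by (intro continuous_intros continuous_on_powr') auto
  then obtain x0 where x0: "x0 \<in> cball y r"
    and max: "\<And>z. z \<in> cball y r \<Longrightarrow> u z - \<phi> z \<le> u x0 - \<phi> x0"
    using continuous_attains_sup[OF compact_cball[of y r], of "\<lambda>x. u x - \<phi> x"] r by auto
  have "u x0 - \<phi> x0 \<le> 0"
  proof (rule ccontr)
    assume pos: "\<not> u x0 - \<phi> x0 \<le> 0"
    then have "x0 \<noteq> y"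
      by (auto simp: \<phi>_def)
    moreover have "dist y x0 \<noteq> r"
    proof
      assume "dist y x0 = r"
      then have "(x0 - y) \<bullet> (x0 - y) = r\<^sup>2"
        by (simp add: dist_norm norm_minus_commute dot_square_norm)
      then have "\<phi> x0 = u y + K"
        using r by (simp add: \<phi>_def A_def)
      then show False
        using pos bound[OF x0] by simp
    qed
    ultimately have V: "x0 \<in> V" "open V" "y \<notin> V"
      using x0 by (auto simp: V_def)
    have "C2_on V \<phi>"
      unfolding \<phi>_def by (rule infinity_laplacian_radial_power(1)[OF V(2,3)])
    moreover have "\<forall>z\<in>V. u z - \<phi> z \<le> u x0 - \<phi> x0"
      using max by (simp add: V_def)
    ultimately have "- infinity_laplacian \<phi> x0 \<le> 0"
      using sub V(1,2) unfolding viscosity_subsolution_on_def by blast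
    moreover have "infinity_laplacian \<phi> x0 < 0"
      unfolding \<phi>_def infinity_laplacian_radial_power(2)[OF V(2,3,1)]
      using A a \<open>x0 \<noteq> y\<close> by (auto intro!: mult_neg_pos mult_pos_neg simp: mult_less_0_iff zero_less_mult_iff)
    ultimately show False by simp
  qed
  then have "u x \<le> \<phi> x"
    using max[OF x] by simp
  also have "\<phi> x = u y + K * (dist x y / r) powr (2 * a)"
  proof -
    have p: "(s\<^sup>2) powr a = s powr (2 * a)" if "s \<ge> 0" for s :: real
      using that by (cases "s = 0") (simp_all add: powr_powr flip: powr_numeral)
    show ?thesis
      using r by (simp add: \<phi>_def A_def dot_square_norm dist_norm p powr_divide)
  qed
  finally show ?thesis by simp
qed

lemma subsolution_below_cone:
  fixes u :: "real ^ 'n::finite \<Rightarrow> real"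
  assumes sub: "viscosity_subsolution_on UNIV u" and cont: "continuous_on UNIV u"
    and r: "r > 0" and K: "K > 0"
    and bound: "\<And>x. x \<in> cball y r \<Longrightarrow> u x - u y \<le> K"
    and x: "x \<in> cball y r"
  shows "u x - u y \<le> K * (dist x y / r)"
proof (cases "x = y")
  case False
  then have t: "dist x y / r > 0"
    using r by simp
  have "((\<lambda>a. K * (dist x y / r) powr (2 * a)) \<longlongrightarrow> K * (dist x y / r) powr (2 * (1 / 2))) (at_left (1 / 2))"
    using t by (intro tendsto_intros) auto
  moreover have "\<forall>\<^sub>F a in at_left (1 / 2 :: real). u x - u y \<le> K * (dist x y / r) powr (2 * a)"
    by (rule eventually_mono[OF eventually_at_left_real[of 0]])
      (auto intro!: subsolution_below_radial_power assms)
  ultimately have "u x - u y \<le> K * (dist x y / r) powr (2 * (1 / 2))"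
    by (intro tendsto_lowerbound) auto
  then show ?thesis
    using t r by simp
qed simp

text \<open>
  Cones from above bound \<open>u x - u y\<close>; applied to \<open>- u\<close>, they bound \<open>u y - u x\<close> with the same centre \<open>y\<close>.
\<close>

lemma infinity_harmonic_lipschitz:
  fixes u :: "real ^ 'n::finite \<Rightarrow> real"
  assumes u: "infinity_harmonic_on UNIV u" and r: "r > 0" and K: "K > 0"
    and bound: "\<And>x. x \<in> cball y r \<Longrightarrow> \<bar>u x - u y\<bar> \<le> K"
    and x: "x \<in> cball y r"
  shows "\<bar>u x - u y\<bar> \<le> K / r * dist x y"
proof -
  have cont: "continuous_on UNIV u" and sub: "viscosity_subsolution_on UNIV u"
    and sub': "viscosity_subsolution_on UNIV (\<lambda>x. - u x)"
    using u viscosity_subsolution_uminus by (auto simp: infinity_harmonic_on_def)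
  have "u x - u y \<le> K * (dist x y / r)"
    using bound by (intro subsolution_below_cone[OF sub cont r K _ x]) force
  moreover have "- u x - - u y \<le> K * (dist x y / r)"
    using bound by (intro subsolution_below_cone[OF sub' continuous_on_minus[OF cont] r K _ x]) force
  ultimately show ?thesis
    by auto
qed

section \<open>Bounding the supremum by the integral\<close>

text \<open>
  Let \<open>x0\<close> maximise the weight \<open>w\<close>, and put \<open>d = R - norm x0\<close>, \<open>S = \<bar>u x0\<bar>\<close>.  Within distance \<open>d / 2\<close> of
  \<open>x0\<close> the factor \<open>(R - norm x) ^ n\<close> drops at most by \<open>2 ^ n\<close>, so maximality gives \<open>\<bar>u\<bar> \<le> C * S\<close> there,
  where \<open>C powr p = 2 ^ n\<close>.  Hence the increments of \<open>u\<close> from \<open>x0\<close> are at most \<open>2 * C * S\<close>, and the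
  Lipschitz bound \<open>4 * C * S / d\<close> keeps \<open>\<bar>u\<bar> \<ge> S / 2\<close> within distance \<open>d / (8 * C)\<close>.  The integral over
  that ball is, up to a constant factor, at least \<open>w x0\<close>, and so at least \<open>w z\<close>.
\<close>

lemma infinity_harmonic_interior_estimate:
  fixes u :: "real ^ 'n::finite \<Rightarrow> real"
  assumes u: "infinity_harmonic_on UNIV u" and p: "p > 0" and R: "R > 0"
    and z: "z \<in> ball 0 R"
  defines "C \<equiv> 2 powr (CARD('n) / p)"
  shows "unit_ball_vol CARD('n) * ((R - norm z) / (8 * C)) ^ CARD('n) * (\<bar>u z\<bar> / 2) powr p
         \<le> (LINT x:ball 0 R|lebesgue. \<bar>u x\<bar> powr p)"
proof -
  let ?N = "CARD('n)"
  define w where "w x = (R - norm x) ^ ?N * \<bar>u x\<bar> powr p" for x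
  have cont: "continuous_on S u" for S
    using u continuous_on_subset by (auto simp: infinity_harmonic_on_def)
  have C: "C \<ge> 1"
    unfolding C_def using p by (intro ge_one_powr_ge_zero) auto
  have Cp: "C powr p = 2 ^ ?N"
    using p by (simp add: C_def powr_powr powr_realpow)
  have contp: "continuous_on S (\<lambda>x. \<bar>u x\<bar> powr p)" for S
    using p cont by (intro continuous_on_powr' continuous_intros) auto
  have int: "set_integrable lebesgue (ball 0 R) (\<lambda>x. \<bar>u x\<bar> powr p)"
  proof -
    have "set_integrable lborel (cball 0 R) (\<lambda>x. \<bar>u x\<bar> powr p)"
      unfolding set_integrable_def by (intro borel_integrable_compact contp) auto
    then have "set_integrable lebesgue (cball 0 R) (\<lambda>x. \<bar>u x\<bar> powr p)"
      unfolding set_integrable_def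
      using integrable_completion borel_measurable_integrable by blast
    then show ?thesis
      by (rule set_integrable_subset) auto
  qed
  have "continuous_on (cball 0 R) w"
    unfolding w_def by (intro continuous_intros contp)
  then obtain x0 where x0: "x0 \<in> cball 0 R" and max: "\<And>x. x \<in> cball 0 R \<Longrightarrow> w x \<le> w x0"
    using continuous_attains_sup[OF compact_cball[of 0 R], of w] R by auto
  define d S where "d = R - norm x0" and "S = \<bar>u x0\<bar>"
  have vol: "unit_ball_vol ?N \<ge> 0" by simp
  have "unit_ball_vol ?N * ((R - norm z) / (8 * C)) ^ ?N * (\<bar>u z\<bar> / 2) powr p
      = unit_ball_vol ?N / (8 * C) ^ ?N / 2 powr p * w z"
    by (simp add: w_def powr_divide power_divide)
  also have "\<dots> \<le> unit_ball_vol ?N / (8 * C) ^ ?N / 2 powr p * w x0"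
    using max[of z] z C vol by (intro mult_left_mono) auto
  also have "\<dots> = unit_ball_vol ?N * (d / (8 * C)) ^ ?N * (S / 2) powr p"
    by (simp add: w_def powr_divide power_divide d_def S_def)
  also have "\<dots> \<le> (LINT x:ball 0 R|lebesgue. \<bar>u x\<bar> powr p)"
  proof (cases "d = 0 \<or> S = 0")
    case True
    have "0 \<le> (LINT x:ball 0 R|lebesgue. \<bar>u x\<bar> powr p)"
      unfolding set_lebesgue_integral_def by (intro Bochner_Integration.integral_nonneg) auto
    then show ?thesis
      using True p by (auto simp: power_0_left)
  next
    case False
    then have d: "d > 0" and S: "S > 0"
      using x0 by (auto simp: d_def S_def)
    have near: "\<bar>u x\<bar> \<le> C * S" if "x \<in> cball x0 (d / 2)" for x
    proof -
      have "norm x \<le> norm x0 + dist x0 x"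
        by (metis add.commute dist_commute dist_norm norm_triangle_sub)
      then have dx: "R - norm x \<ge> d / 2"
        using that by (simp add: d_def)
      then have "(d / 2) ^ ?N * \<bar>u x\<bar> powr p \<le> w x"
        unfolding w_def using d by (intro mult_right_mono power_mono) auto
      also have "\<dots> \<le> w x0"
        using dx d by (intro max) auto
      also have "\<dots> = (d / 2) ^ ?N * (C * S) powr p"
        using C S by (simp add: w_def powr_mult Cp power_divide flip: d_def S_def)
      finally have "\<bar>u x\<bar> powr p \<le> (C * S) powr p"
        using d by simp
      then show ?thesis
        using powr_less_mono2[of p "C * S" "\<bar>u x\<bar>"] C S p by fastforce
    qed
    have large: "S / 2 \<le> \<bar>u x\<bar>" if "x \<in> ball x0 (d / (8 * C))" for x
    proof -
      have "d / (8 * C) \<le> d / 2"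
        using C d by (intro divide_left_mono) auto
      then have x: "x \<in> cball x0 (d / 2)"
        using that by auto
      have "\<bar>u x - u x0\<bar> \<le> (2 * C * S) / (d / 2) * dist x x0"
      proof (rule infinity_harmonic_lipschitz[OF u _ _ _ x])
        show "\<bar>u x - u x0\<bar> \<le> 2 * C * S" if "x \<in> cball x0 (d / 2)" for x
          using near[OF that] near[of x0] d by auto
      qed (use d C S in auto)
      also have "\<dots> \<le> (2 * C * S) / (d / 2) * (d / (8 * C))"
        using that C S d by (intro mult_left_mono) (auto simp: dist_commute)
      also have "\<dots> = S / 2"
        using C d by simp
      finally show ?thesis
        unfolding S_def by linarith
    qed
    have sub: "ball x0 (d / (8 * C)) \<subseteq> ball 0 R"
    proof
      fix x assume x: "x \<in> ball x0 (d / (8 * C))"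
      have "norm x \<le> norm x0 + dist x0 x"
        by (metis add.commute dist_commute dist_norm norm_triangle_sub)
      moreover have "d / (8 * C) \<le> d / 1"
        using C d by (intro divide_left_mono) auto
      ultimately show "x \<in> ball 0 R"
        using x by (simp add: d_def)
    qed
    have "unit_ball_vol ?N * (d / (8 * C)) ^ ?N * (S / 2) powr p
        = (LINT x:ball x0 (d / (8 * C))|lebesgue. (S / 2) powr p)"
      using d C by (simp add: set_lebesgue_integral_def content_ball emeasure_lborel_ball_finite)
    also have "\<dots> \<le> (LINT x:ball x0 (d / (8 * C))|lebesgue. \<bar>u x\<bar> powr p)"
    proof (rule set_integral_mono)
      show "set_integrable lebesgue (ball x0 (d / (8 * C))) (\<lambda>x. (S / 2) powr p)"
        unfolding set_integrable_def by (simp flip: lmeasurable_iff_integrable)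
      show "set_integrable lebesgue (ball x0 (d / (8 * C))) (\<lambda>x. \<bar>u x\<bar> powr p)"
        using sub by (intro set_integrable_subset[OF int]) auto
      show "(S / 2) powr p \<le> \<bar>u x\<bar> powr p" if "x \<in> ball x0 (d / (8 * C))" for x
        using large[OF that] S p by (intro powr_mono2) auto
    qed
    also have "\<dots> \<le> (LINT x:ball 0 R|lebesgue. \<bar>u x\<bar> powr p)"
      unfolding set_lebesgue_integral_def
    proof (rule integral_mono)
      show "integrable lebesgue (\<lambda>x. indicator (ball x0 (d / (8 * C))) x *\<^sub>R \<bar>u x\<bar> powr p)"
        using set_integrable_subset[OF int _ sub] by (simp add: set_integrable_def)
      show "integrable lebesgue (\<lambda>x. indicator (ball 0 R) x *\<^sub>R \<bar>u x\<bar> powr p)"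
        using int by (simp add: set_integrable_def)
    qed (use sub in \<open>auto simp: indicator_def\<close>)
    finally show ?thesis .
  qed
  finally show ?thesis .
qed

section \<open>The Liouville theorem\<close>

lemma infinity_harmonic_constant_if_sublinear:
  fixes u :: "real ^ 'n::finite \<Rightarrow> real"
  assumes u: "infinity_harmonic_on UNIV u"
    and growth: "\<And>e. e > 0 \<Longrightarrow> \<exists>\<^sub>F R in at_top. \<forall>z\<in>cball 0 (R / 2). \<bar>u z\<bar> \<le> e * R"
  shows "u constant_on UNIV"
proof -
  have "u x = u 0" for x
  proof (rule ccontr)
    assume ne: "u x \<noteq> u 0"
    then have x: "x \<noteq> 0" by auto
    \<comment> \<open>Chosen so that the Lipschitz bound \<open>4 * e\<close> allows only half of the assumed increment.\<close>
    define e where "e = \<bar>u x - u 0\<bar> / (8 * norm x)"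
    have e: "e > 0"
      using ne x by (simp add: e_def)
    have "\<exists>\<^sub>F R in at_top. (\<forall>z\<in>cball 0 (R / 2). \<bar>u z\<bar> \<le> e * R) \<and> R \<ge> 2 * norm x"
      by (intro frequently_eventually_frequently growth e eventually_ge_at_top)
    then obtain R where R: "\<And>z. z \<in> cball 0 (R / 2) \<Longrightarrow> \<bar>u z\<bar> \<le> e * R" and Rx: "R \<ge> 2 * norm x"
      using frequently_ex by blast
    have Rpos: "R > 0"
      using Rx x by (smt (verit) zero_less_norm_iff)
    have "\<bar>u x - u 0\<bar> \<le> (2 * e * R) / (R / 2) * dist x 0"
    proof (rule infinity_harmonic_lipschitz[OF u])
      show "\<bar>u z - u 0\<bar> \<le> 2 * e * R" if "z \<in> cball 0 (R / 2)" for z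
        using R[OF that] R[of 0] Rpos by auto
    qed (use Rpos Rx e in auto)
    also have "\<dots> = 4 * e * norm x"
      using Rpos by simp
    also have "\<dots> = \<bar>u x - u 0\<bar> / 2"
      using x by (simp add: e_def)
    finally show False
      using ne by simp
  qed
  then show ?thesis
    by (auto simp: constant_on_def)
qed

text \<open>
  The constant \<open>c\<close> collects the factors of the interior estimate at points with \<open>R - norm z \<ge> R / 2\<close>,
  so that \<open>c * \<bar>u z\<bar> powr p\<close> is at most the normalised integral over the ball of radius \<open>R\<close>.
\<close>

theorem corollary1p7:
  fixes u :: "real ^ 2 \<Rightarrow> real" and p :: real
  assumes "infinity_harmonic_on UNIV u"
    and "p > 2"
    and "Liminf at_top (\<lambda>R::real. ereal (1 / R *
           (1 / R ^ 2 * (LINT x:ball 0 R|lebesgue. \<bar>u x\<bar> powr p)) powr (1 / p))) = 0"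
  shows "u constant_on UNIV"
proof (rule infinity_harmonic_constant_if_sublinear[OF assms(1)])
  fix e :: real assume e: "e > 0"
  define I where "I R = (LINT x:ball 0 R|lebesgue. \<bar>u x\<bar> powr p)" for R
  define F where "F R = 1 / R * (1 / R ^ 2 * I R) powr (1 / p)" for R
  define c where "c = unit_ball_vol 2 / (16 * 2 powr (2 / p)) ^ 2 / 2 powr p"
  have c: "c > 0"
    by (simp add: c_def)
  have p: "p > 0" using assms(2) by simp
  define e' where "e' = e * c powr (1 / p)"
  have e': "e' > 0"
    using e c by (simp add: e'_def)
  \<comment> \<open>A zero lower limit yields smallness only along arbitrarily large radii, not for all of them.\<close>
  have "\<exists>\<^sub>F R in at_top. F R < e'"
  proof (rule ccontr)
    assume "\<not> (\<exists>\<^sub>F R in at_top. F R < e')"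
    then have "\<forall>\<^sub>F R in at_top. ereal e' \<le> ereal (F R)"
      by (simp add: not_frequently not_less)
    then have "ereal e' \<le> Liminf at_top (\<lambda>R. ereal (F R))"
      by (rule Liminf_bounded)
    then show False
      using assms(3) e' by (simp add: F_def I_def)
  qed
  then have "\<exists>\<^sub>F R in at_top. F R < e' \<and> R > 0"
    by (intro frequently_eventually_frequently eventually_gt_at_top)
  then show "\<exists>\<^sub>F R in at_top. \<forall>z\<in>cball 0 (R / 2). \<bar>u z\<bar> \<le> e * R"
  proof (rule frequently_elim1, safe)
    fix R :: real and z :: "real ^ 2"
    assume F: "F R < e'" and R: "0 < R" and z: "z \<in> cball 0 (R / 2)"
    have "c * R ^ 2 * \<bar>u z\<bar> powr p =
        unit_ball_vol 2 * (R / 2 / (8 * 2 powr (2 / p))) ^ 2 * (\<bar>u z\<bar> / 2) powr p"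
      by (simp add: c_def powr_divide power_divide power_mult_distrib)
    also have "\<dots> \<le> unit_ball_vol 2 * ((R - norm z) / (8 * 2 powr (2 / p))) ^ 2 * (\<bar>u z\<bar> / 2) powr p"
      using z R by (intro mult_right_mono mult_left_mono power_mono divide_right_mono) auto
    also have "\<dots> \<le> I R"
      using infinity_harmonic_interior_estimate[OF assms(1) p R, of z] z R by (simp add: I_def)
    finally have "c * \<bar>u z\<bar> powr p \<le> 1 / R ^ 2 * I R"
      using R by (simp add: field_simps)
    then have "(c * \<bar>u z\<bar> powr p) powr (1 / p) \<le> (1 / R ^ 2 * I R) powr (1 / p)"
      using c p by (intro powr_mono2) auto
    also have "\<dots> = R * F R"
      using R by (simp add: F_def)
    also have "\<dots> \<le> R * e'"
      using F R by simp
    also have "(c * \<bar>u z\<bar> powr p) powr (1 / p) = c powr (1 / p) * \<bar>u z\<bar>"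
      using c p by (simp add: powr_mult powr_powr)
    finally show "\<bar>u z\<bar> \<le> e * R"
      using c by (simp add: e'_def mult.commute mult.left_commute)
  qed
qed

end
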